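(* Let $T$ be an infinite rooted tree, let $\psi:T\to\mathbb{C}$ be a function and let $0<p<\infty$. Then the following are equivalent: (a) The multiplication operator $M_\psi:\mathbb{T}_p\to\mathbb{T}_\infty$ is bounded. (b) The multiplication operator $M_\psi:\mathbb{T}_{p,0}\to\mathbb{T}_{\infty,0}$ is bounded. (c) $\sup_{n\in\mathbb{N}_0}\left\{c_n^{1/p}M_\infty(n,\psi)\right\}<\infty$. Moreover, in this case $\|M_\psi\|=\sup_{n\in\mathbb{N}_0}\left\{c_n^{1/p}M_\infty(n,\psi)\right\}$.
   Context: Let $T$ be an infinite rooted tree with root $o$; $T$ also denotes its vertex set. For a vertex $v$, $|v|$ is the number of edges in the unique path from $o$ to $v$. For $n\in\mathbb{N}_0=\{0,1,2,\dots\}$, $D_n=\{v\in T:|v|=n\}$, and $c_n$ is the number of elements of $D_n$, assumed finite for each $n$ (so $1\le c_n<\infty$). For $f:T\to\mathbb{C}$ and $0<p<\infty$ put $M_p(n,f)=\left(\frac1{c_n}\sum_{|v|=n}|f(v)|^p\right)^{1/p}$, and $M_\infty(n,f)=\max_{|v|=n}|f(v)|$. For $0<p\le\infty$ put $\|f\|_p=\sup_{n\in\mathbb{N}_0}M_p(n,f)$, $\mathbb{T}_p=\{f:T\to\mathbb{C}:\|f\|_p<\infty\}$ and $\mathbb{T}_{p,0}=\{f\in\mathbb{T}_p:\lim_{n\to\infty}M_p(n,f)=0\}$ (with the same $\|\cdot\|_p$). For $\psi:T\to\mathbb{C}$, $M_\psi f=\psi f$ (pointwise product). $M_\psi:X\to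 Y$ is bounded if $\psi f\in Y$ for every $f\in X$ and $\|M_\psi\|:=\sup\{\|\psi f\|_Y/\|f\|_X: f\in X, f\neq0\}<\infty$; the norm formula holds for the operator in (a) as well as for the one in (b). *)

theory Defs
  imports "Graph_Theory.Pair_Digraph" "HOL-Library.Extended_Real" Complex_Main
begin

text \<open>
  A \<^locale>\<open>pair_bidirected_digraph\<close> is a symmetric loop-free digraph without parallel arcs, i.e. an
  undirected simple graph, possibly infinite.  The predicate called \<open>tree\<close> in Graph_Theory is not
  usable here: its cycles are directed ones, so an undirected edge already counts as a cycle,
  while an acyclically oriented polygon is accepted.  We use existence and uniqueness of paths.
\<close>

locale rooted_tree = pair_bidirected_digraph G for G :: "'a pair_pre_digraph" +
  fixes r :: 'a
  assumes root_in_verts: "r \<in> pverts G"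
    and unique_path: "\<lbrakk>u \<in> pverts G; v \<in> pverts G\<rbrakk> \<Longrightarrow> \<exists>!P. apath u P v"

definition depth :: "'a pair_pre_digraph \<Rightarrow> 'a \<Rightarrow> 'a \<Rightarrow> nat" where
  "depth G r v = length (THE P. pre_digraph.apath (with_proj G) r P v)"

definition level :: "'a pair_pre_digraph \<Rightarrow> 'a \<Rightarrow> nat \<Rightarrow> 'a set" where
  "level G r n = {v \<in> pverts G. depth G r v = n}"

definition level_mean ::
    "'a pair_pre_digraph \<Rightarrow> 'a \<Rightarrow> ereal \<Rightarrow> nat \<Rightarrow> ('a \<Rightarrow> complex) \<Rightarrow> real" where
  "level_mean G r p n f =
     (if p = \<infinity> then Max ((\<lambda>v. cmod (f v)) ` level G r n)
      else (1 / real (card (level G r n)) *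
              (\<Sum>v\<in>level G r n. cmod (f v) powr real_of_ereal p)) powr (1 / real_of_ereal p))"

definition tree_norm :: "'a pair_pre_digraph \<Rightarrow> 'a \<Rightarrow> ereal \<Rightarrow> ('a \<Rightarrow> complex) \<Rightarrow> ereal" where
  "tree_norm G r p f = (SUP n. ereal (level_mean G r p n f))"

text \<open>
  Functions on the vertex set are represented by functions on the whole type; every notion below
  depends only on the values at vertices.
\<close>

definition tree_space :: "'a pair_pre_digraph \<Rightarrow> 'a \<Rightarrow> ereal \<Rightarrow> ('a \<Rightarrow> complex) set" where
  "tree_space G r p = {f. tree_norm G r p f < \<infinity>}"

definition tree_space0 :: "'a pair_pre_digraph \<Rightarrow> 'a \<Rightarrow> ereal \<Rightarrow> ('a \<Rightarrow> complex) set" where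
  "tree_space0 G r p = {f \<in> tree_space G r p. (\<lambda>n. level_mean G r p n f) \<longlonglongrightarrow> 0}"

definition mult_op :: "('a \<Rightarrow> complex) \<Rightarrow> ('a \<Rightarrow> complex) \<Rightarrow> 'a \<Rightarrow> complex" where
  "mult_op \<psi> f = (\<lambda>v. \<psi> v * f v)"

text \<open>
  In the next two definitions \<open>X\<close> carries the norm with exponent \<open>p\<close> and \<open>Y\<close> the norm with
  exponent \<open>q\<close>.
\<close>

definition op_norm ::
    "'a pair_pre_digraph \<Rightarrow> 'a \<Rightarrow> ereal \<Rightarrow> ('a \<Rightarrow> complex) set \<Rightarrow> ereal \<Rightarrow>
       (('a \<Rightarrow> complex) \<Rightarrow> 'a \<Rightarrow> complex) \<Rightarrow> ereal" where
  "op_norm G r p X q A =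
     (SUP f\<in>{f \<in> X. \<exists>v\<in>pverts G. f v \<noteq> 0}. tree_norm G r q (A f) / tree_norm G r p f)"

definition bounded_op ::
    "'a pair_pre_digraph \<Rightarrow> 'a \<Rightarrow> ereal \<Rightarrow> ('a \<Rightarrow> complex) set \<Rightarrow> ereal \<Rightarrow> ('a \<Rightarrow> complex) set \<Rightarrow>
       (('a \<Rightarrow> complex) \<Rightarrow> 'a \<Rightarrow> complex) \<Rightarrow> bool" where
  "bounded_op G r p X q Y A \<longleftrightarrow> (\<forall>f\<in>X. A f \<in> Y) \<and> op_norm G r p X q A < \<infinity>"

end

theory Submission
  imports Defs
begin

text \<open>
  Since a single term of the level sum is at most the whole sum, \<open>|f v| \<le> c\<^sub>n powr (1/p) * M\<^sub>p(n,f)\<close>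
  on level \<open>n\<close>, with equality for the indicator function of a vertex.  Hence the operator norm equals
  the supremum, as an extended real, on every domain containing the indicator functions, and
  boundedness amounts to finiteness of the supremum.
\<close>

section \<open>Levels of an infinite tree with finite levels\<close>

locale locally_finite_tree = rooted_tree +
  assumes infinite_verts: "infinite (pverts G)"
    and finite_level: "finite (level G r n)"
begin

lemma depth_eq_length:
  assumes "apath r P v"
  shows "depth G r v = length P"
proof -
  have "v \<in> pverts G"
    using assms awalk_last_in_verts[of r P v] by (auto simp: apath_def)
  then have "(THE Q. apath r Q v) = P"
    using unique_path[OF root_in_verts] assms by (intro the1_equality) auto
  then show ?thesis
    by (simp add: depth_def)
qed

text \<open>The first \<open>n\<close> arcs of the path from the root to \<open>v\<close> again form
  a path, and its end point lies on level \<open>n\<close>.\<close>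

lemma level_downward:
  assumes "v \<in> pverts G" and "n \<le> depth G r v"
  shows "level G r n \<noteq> {}"
proof -
  obtain P where P: "apath r P v"
    using unique_path[OF root_in_verts assms(1)] by blast
  have "apath r (take n P @ drop n P) v"
    using P by (simp only: append_take_drop_id)
  then obtain w where w: "apath r (take n P) w"
    using apath_append_iff[THEN iffD1, THEN conjunct1] by blast
  then have "w \<in> pverts G"
    using awalk_last_in_verts[of r "take n P" w] by (auto simp: apath_def)
  moreover have "depth G r w = n"
    using depth_eq_length[OF w] depth_eq_length[OF P] assms(2) by simp
  ultimately show ?thesis
    by (auto simp: level_def)
qed

text \<open>If level \<open>n\<close> were empty, every vertex would have depth below
  \<open>n\<close>, and the vertex set would be a finite union of finite levels.\<close>

lemma level_nonempty: "level G r n \<noteq> {}"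
proof
  assume "level G r n = {}"
  then have "pverts G \<subseteq> (\<Union>m<n. level G r m)"
    using level_downward[of _ n] by (force simp: level_def not_le[symmetric])
  then show False
    using infinite_verts finite_level finite_subset by blast
qed

lemma card_level_pos: "card (level G r n) > 0"
  using level_nonempty finite_level by (simp add: card_gt_0_iff)

section \<open>Level means and norms\<close>

lemma cmod_le_level_mean_infinity:
  assumes "v \<in> level G r n"
  shows "cmod (f v) \<le> level_mean G r \<infinity> n f"
  using assms finite_level by (auto simp: level_mean_def intro!: Max_ge)

lemma level_mean_infinity_le:
  assumes "\<And>v. v \<in> level G r n \<Longrightarrow> cmod (f v) \<le> C"
  shows "level_mean G r \<infinity> n f \<le> C"
  using assms finite_level level_nonempty by (auto simp: level_mean_def)

lemma level_mean_infinity_attained: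
  obtains v where "v \<in> level G r n" "level_mean G r \<infinity> n f = cmod (f v)"
proof -
  have "level_mean G r \<infinity> n f \<in> (\<lambda>v. cmod (f v)) ` level G r n"
    unfolding level_mean_def using finite_level level_nonempty by (auto intro!: Max_in)
  then show ?thesis
    using that by blast
qed

text \<open>For \<open>q = \<infinity>\<close> the maximum is attained by some absolute value;
  otherwise the mean is a value of \<open>powr\<close>, which is never negative.\<close>

lemma level_mean_nonneg: "0 \<le> level_mean G r q n f"
proof (cases "q = \<infinity>")
  case True
  then show ?thesis
    by (metis level_mean_infinity_attained norm_ge_zero)
qed (simp add: level_mean_def)

lemma level_mean_le_tree_norm: "ereal (level_mean G r q n f) \<le> tree_norm G r q f"
  unfolding tree_norm_def by (rule SUP_upper) simp

lemma tree_norm_nonneg: "0 \<le> tree_norm G r q f"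
  using level_mean_le_tree_norm[of q 0 f] level_mean_nonneg[of q 0 f]
  by (metis ereal_less_eq(5) order_trans)

lemma cmod_le_level_mean:
  assumes "0 < p" and "v \<in> level G r n"
  shows "cmod (f v) \<le> real (card (level G r n)) powr (1 / p) * level_mean G r (ereal p) n f"
proof -
  let ?c = "real (card (level G r n))" and ?s = "\<Sum>v\<in>level G r n. cmod (f v) powr p"
  have "cmod (f v) powr p \<le> ?s"
    using assms(2) finite_level by (intro member_le_sum) auto
  then have "(cmod (f v) powr p) powr (1 / p) \<le> ?s powr (1 / p)"
    using assms(1) by (intro powr_mono2) auto
  \<comment> \<open>Splitting off \<open>?c\<close>, which is positive, makes the averaged sum of
    \<open>level_mean\<close> appear.\<close>
  also have "?s = ?c * (1 / ?c * ?s)"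
    using card_level_pos[of n] by simp
  also have "\<dots> powr (1 / p) = ?c powr (1 / p) * (1 / ?c * ?s) powr (1 / p)"
    by (rule powr_mult)
  finally show ?thesis
    using assms(1) by (simp add: powr_powr level_mean_def)
qed

section \<open>Upper bound for the operator norm\<close>

lemma level_mean_mult_op_le:
  assumes "0 < p"
  shows "level_mean G r \<infinity> n (mult_op \<psi> f) \<le>
    level_mean G r (ereal p) n f * (real (card (level G r n)) powr (1 / p) * level_mean G r \<infinity> n \<psi>)"
proof (rule level_mean_infinity_le)
  fix v
  assume v: "v \<in> level G r n"
  \<comment> \<open>The power of the level size comes from the bound on \<open>f\<close>; regrouping
    attaches it to the maximum of \<open>\<psi>\<close>.\<close>
  have "cmod (\<psi> v) * cmod (f v) \<le> level_mean G r \<infinity> n \<psi> *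
      (real (card (level G r n)) powr (1 / p) * level_mean G r (ereal p) n f)"
    using v assms level_mean_nonneg
    by (intro mult_mono cmod_le_level_mean_infinity cmod_le_level_mean) auto
  then show "cmod (mult_op \<psi> f v) \<le> level_mean G r (ereal p) n f *
      (real (card (level G r n)) powr (1 / p) * level_mean G r \<infinity> n \<psi>)"
    by (simp add: mult_op_def norm_mult mult_ac)
qed

text \<open>Taken in \<open>ereal\<close>, so that it can be compared with \<open>op_norm\<close>
  before either is known to be finite.\<close>

definition weight_sup :: "real \<Rightarrow> ('a \<Rightarrow> complex) \<Rightarrow> ereal" where
  "weight_sup p \<psi> =
    (SUP n. ereal (real (card (level G r n)) powr (1 / p) * level_mean G r \<infinity> n \<psi>))"

lemma weight_le_weight_sup:
  "ereal (real (card (level G r n)) powr (1 / p) * level_mean G r \<infinity> n \<psi>) \<le> weight_sup p \<psi>"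
  unfolding weight_sup_def by (rule SUP_upper) simp

lemma weight_sup_nonneg: "0 \<le> weight_sup p \<psi>"
proof -
  have "0 \<le> ereal (real (card (level G r 0)) powr (1 / p) * level_mean G r \<infinity> 0 \<psi>)"
    by (simp add: level_mean_nonneg)
  then show ?thesis
    using weight_le_weight_sup order_trans by blast
qed

lemma tree_norm_mult_op_le:
  assumes "0 < p"
  shows "tree_norm G r \<infinity> (mult_op \<psi> f) \<le> tree_norm G r (ereal p) f * weight_sup p \<psi>"
proof -
  have "ereal (level_mean G r \<infinity> n (mult_op \<psi> f)) \<le> tree_norm G r (ereal p) f * weight_sup p \<psi>" for n
  proof -
    have "ereal (level_mean G r \<infinity> n (mult_op \<psi> f)) \<le> ereal (level_mean G r (ereal p) n f) *
        ereal (real (card (level G r n)) powr (1 / p) * level_mean G r \<infinity> n \<psi>)"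
      using level_mean_mult_op_le[OF assms, of n \<psi> f] by simp
    \<comment> \<open>Each factor is at most its own supremum over the levels; nonnegativity makes
      the product in \<open>ereal\<close> monotone.\<close>
    also have "\<dots> \<le> tree_norm G r (ereal p) f * weight_sup p \<psi>"
      using level_mean_nonneg level_mean_le_tree_norm weight_le_weight_sup tree_norm_nonneg
      by (intro ereal_mult_mono) auto
    finally show ?thesis .
  qed
  then show ?thesis
    unfolding tree_norm_def[of G r \<infinity>] by (rule SUP_least)
qed

text \<open>A nonzero value at \<open>v\<close> forces a nonzero mean on the level of
  \<open>v\<close>. This makes the denominators in \<open>op_norm\<close> positive.\<close>

lemma tree_norm_pos:
  assumes "0 < p" and "v \<in> pverts G" and "f v \<noteq> 0"
  shows "0 < tree_norm G r (ereal p) f"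
proof -
  define n where "n = depth G r v"
  have "v \<in> level G r n"
    using assms(2) by (simp add: level_def n_def)
  from cmod_le_level_mean[OF assms(1) this, of f]
  have "level_mean G r (ereal p) n f \<noteq> 0"
    using assms(3) by auto
  then have "0 < ereal (level_mean G r (ereal p) n f)"
    using level_mean_nonneg[of "ereal p" n f] by simp
  then show ?thesis
    using level_mean_le_tree_norm less_le_trans by blast
qed

lemma op_norm_mult_op_le:
  assumes "0 < p" and "X \<subseteq> tree_space G r (ereal p)"
  shows "op_norm G r (ereal p) X \<infinity> (mult_op \<psi>) \<le> weight_sup p \<psi>"
  unfolding op_norm_def
proof (rule SUP_least, clarify)
  fix f v
  assume f: "f \<in> X" "v \<in> pverts G" "f v \<noteq> 0"
  \<comment> \<open>Division in \<open>ereal\<close> may be cleared because the denominator is both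
    finite and positive.\<close>
  then have "tree_norm G r (ereal p) f \<noteq> \<infinity>"
    using assms(2) by (auto simp: tree_space_def)
  then show "tree_norm G r \<infinity> (mult_op \<psi> f) / tree_norm G r (ereal p) f \<le> weight_sup p \<psi>"
    using tree_norm_pos[where f = f, OF assms(1) f(2,3)] tree_norm_mult_op_le[OF assms(1)]
    by (simp add: ereal_divide_le_pos)
qed

section \<open>Vertex indicators and the lower bound\<close>

definition vertex_indicator :: "'a \<Rightarrow> 'a \<Rightarrow> complex" where
  "vertex_indicator v = (\<lambda>w. if w = v then 1 else 0)"

lemma level_mean_vertex_indicator:
  assumes "0 < p" and "v \<in> level G r n"
  shows "level_mean G r (ereal p) m (vertex_indicator v) =
    (if m = n then 1 / real (card (level G r n)) powr (1 / p) else 0)"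
proof -
  have "(\<Sum>w\<in>level G r m. cmod (vertex_indicator v w) powr p) =
      (\<Sum>w\<in>level G r m. if w = v then 1 else 0)"
    by (intro sum.cong) (auto simp: vertex_indicator_def)
  \<comment> \<open>A vertex has only one depth, so \<open>v\<close> contributes to the sum over
    level \<open>n\<close> and to no other.\<close>
  also have "\<dots> = (if m = n then 1 else 0)"
    using assms(2) finite_level by (auto simp: level_def sum.delta)
  finally show ?thesis
    using assms(1) by (simp add: level_mean_def powr_divide)
qed

lemma tree_norm_vertex_indicator:
  assumes "0 < p" and "v \<in> level G r n"
  shows "tree_norm G r (ereal p) (vertex_indicator v) =
    ereal (1 / real (card (level G r n)) powr (1 / p))"
proof (rule antisym)
  show "tree_norm G r (ereal p) (vertex_indicator v) \<le>
      ereal (1 / real (card (level G r n)) powr (1 / p))"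
    unfolding tree_norm_def using assms
    by (intro SUP_least) (simp add: level_mean_vertex_indicator)
  show "ereal (1 / real (card (level G r n)) powr (1 / p)) \<le>
      tree_norm G r (ereal p) (vertex_indicator v)"
    using level_mean_le_tree_norm[of "ereal p" n "vertex_indicator v"] assms
    by (simp add: level_mean_vertex_indicator)
qed

text \<open>The means vanish beyond level \<open>n\<close>. The test functions thus lie in the
  smaller domain, and one lower bound serves both operators.\<close>

lemma vertex_indicator_in_tree_space0:
  assumes "0 < p" and "v \<in> level G r n"
  shows "vertex_indicator v \<in> tree_space0 G r (ereal p)"
proof -
  have "eventually (\<lambda>m. level_mean G r (ereal p) m (vertex_indicator v) = 0) sequentially"
    using eventually_gt_at_top[of n]
    by eventually_elim (simp add: level_mean_vertex_indicator[OF assms])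
  then have "(\<lambda>m. level_mean G r (ereal p) m (vertex_indicator v)) \<longlonglongrightarrow> 0"
    by (rule tendsto_eventually)
  then show ?thesis
    using assms by (simp add: tree_space0_def tree_space_def tree_norm_vertex_indicator)
qed

lemma weight_sup_le_op_norm:
  assumes "0 < p" and "tree_space0 G r (ereal p) \<subseteq> X"
  shows "weight_sup p \<psi> \<le> op_norm G r (ereal p) X \<infinity> (mult_op \<psi>)"
  unfolding weight_sup_def
proof (rule SUP_least)
  fix n
  let ?c = "real (card (level G r n)) powr (1 / p)"
  \<comment> \<open>The test function sits at a vertex where the absolute value of
    \<open>\<psi>\<close> is maximal on level \<open>n\<close>; its norm is \<open>1 / ?c\<close>,
    so dividing by it produces the weight.\<close>
  obtain v where v: "v \<in> level G r n" and max: "level_mean G r \<infinity> n \<psi> = cmod (\<psi> v)"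
    by (rule level_mean_infinity_attained)
  let ?f = "vertex_indicator v"
  have c: "?c > 0"
    using card_level_pos[of n] by simp
  have norm: "tree_norm G r (ereal p) ?f = ereal (1 / ?c)"
    by (rule tree_norm_vertex_indicator[OF assms(1) v])
  have "cmod (\<psi> v) \<le> level_mean G r \<infinity> n (mult_op \<psi> ?f)"
    using cmod_le_level_mean_infinity[OF v, of "mult_op \<psi> ?f"]
    by (simp add: mult_op_def vertex_indicator_def)
  then have "ereal (cmod (\<psi> v)) \<le> tree_norm G r \<infinity> (mult_op \<psi> ?f)"
    using level_mean_le_tree_norm[of \<infinity> n "mult_op \<psi> ?f"] by (meson ereal_less_eq(3) order_trans)
  then have "ereal (?c * level_mean G r \<infinity> n \<psi>) \<le>
      tree_norm G r \<infinity> (mult_op \<psi> ?f) / tree_norm G r (ereal p) ?f"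
    using c unfolding norm max by (subst ereal_le_divide_pos) auto
  also have "\<dots> \<le> op_norm G r (ereal p) X \<infinity> (mult_op \<psi>)"
    unfolding op_norm_def
    using v assms(2) vertex_indicator_in_tree_space0[OF assms(1) v]
    by (intro SUP_upper) (auto simp: level_def vertex_indicator_def)
  finally show "ereal (?c * level_mean G r \<infinity> n \<psi>) \<le> op_norm G r (ereal p) X \<infinity> (mult_op \<psi>)" .
qed

text \<open>The two inclusions admit both \<open>tree_space\<close> and \<open>tree_space0\<close>
  as \<open>X\<close>.\<close>

lemma op_norm_mult_op:
  assumes "0 < p"
    and "tree_space0 G r (ereal p) \<subseteq> X" and "X \<subseteq> tree_space G r (ereal p)"
  shows "op_norm G r (ereal p) X \<infinity> (mult_op \<psi>) = weight_sup p \<psi>"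
  using assms by (intro antisym op_norm_mult_op_le weight_sup_le_op_norm)

section \<open>Mapping properties when the supremum is finite\<close>

lemma mult_op_in_tree_space:
  assumes "0 < p" and "weight_sup p \<psi> < \<infinity>" and "f \<in> tree_space G r (ereal p)"
  shows "mult_op \<psi> f \<in> tree_space G r \<infinity>"
proof -
  have "tree_norm G r (ereal p) f < \<infinity>"
    using assms(3) by (simp add: tree_space_def)
  \<comment> \<open>Nonnegativity excludes the value \<open>-\<infinity>\<close>.\<close>
  then obtain N where "tree_norm G r (ereal p) f = ereal N"
    using tree_norm_nonneg[of "ereal p" f] by (cases "tree_norm G r (ereal p) f") auto
  moreover obtain K where "weight_sup p \<psi> = ereal K"
    using assms(2) weight_sup_nonneg[of p \<psi>] by (cases "weight_sup p \<psi>") auto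
  ultimately have "tree_norm G r \<infinity> (mult_op \<psi> f) \<le> ereal (N * K)"
    using tree_norm_mult_op_le[OF assms(1), of \<psi> f] by simp
  then show ?thesis
    by (auto simp: tree_space_def)
qed

lemma mult_op_in_tree_space0:
  assumes "0 < p" and "weight_sup p \<psi> < \<infinity>" and "f \<in> tree_space0 G r (ereal p)"
  shows "mult_op \<psi> f \<in> tree_space0 G r \<infinity>"
proof -
  obtain K where K: "weight_sup p \<psi> = ereal K"
    using assms(2) weight_sup_nonneg[of p \<psi>] by (cases "weight_sup p \<psi>") auto
  \<comment> \<open>The bound is kept level by level, with a constant independent of
    \<open>n\<close>, since an inequality between norms would not transfer the decay.\<close>
  have le: "level_mean G r \<infinity> n (mult_op \<psi> f) \<le> level_mean G r (ereal p) n f * K" for n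
  proof -
    have "real (card (level G r n)) powr (1 / p) * level_mean G r \<infinity> n \<psi> \<le> K"
      using weight_le_weight_sup[of n p \<psi>] K by simp
    then show ?thesis
      using level_mean_mult_op_le[OF assms(1), of n \<psi> f] level_mean_nonneg[of "ereal p" n f]
      by (meson mult_left_mono order_trans)
  qed
  have "(\<lambda>n. level_mean G r (ereal p) n f * K) \<longlonglongrightarrow> 0"
    using assms(3) by (auto simp: tree_space0_def intro: tendsto_mult_left_zero)
  then have "(\<lambda>n. level_mean G r \<infinity> n (mult_op \<psi> f)) \<longlonglongrightarrow> 0"
    by (rule tendsto_sandwich[OF always_eventually always_eventually tendsto_const, rotated 2])
      (simp_all add: level_mean_nonneg le)
  then show ?thesis
    using mult_op_in_tree_space[OF assms(1,2)] assms(3) by (simp add: tree_space0_def)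
qed

end

theorem theorem3:
  fixes G :: "'a pair_pre_digraph" and r :: 'a and \<psi> :: "'a \<Rightarrow> complex" and p :: real
  assumes "rooted_tree G r"
    and "infinite (pverts G)"
    and "\<And>n. finite (level G r n)"
    and "0 < p"
  defines "a \<equiv> bounded_op G r (ereal p) (tree_space G r (ereal p)) \<infinity> (tree_space G r \<infinity>) (mult_op \<psi>)"
    and "b \<equiv> bounded_op G r (ereal p) (tree_space0 G r (ereal p)) \<infinity> (tree_space0 G r \<infinity>) (mult_op \<psi>)"
    and "S \<equiv> (SUP n. ereal (real (card (level G r n)) powr (1 / p) * level_mean G r \<infinity> n \<psi>))"
  shows "(a \<longleftrightarrow> b) \<and> (b \<longleftrightarrow> S < \<infinity>) \<and>
    (S < \<infinity> \<longrightarrow>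
       op_norm G r (ereal p) (tree_space G r (ereal p)) \<infinity> (mult_op \<psi>) = S \<and>
       op_norm G r (ereal p) (tree_space0 G r (ereal p)) \<infinity> (mult_op \<psi>) = S)"
proof -
  interpret locally_finite_tree G r
    using assms(1-3) by (simp add: locally_finite_tree_def locally_finite_tree_axioms_def)
  have S: "S = weight_sup p \<psi>"
    by (simp add: S_def weight_sup_def)
  have sub: "tree_space0 G r (ereal p) \<subseteq> tree_space G r (ereal p)"
    by (auto simp: tree_space0_def)
  have norms: "op_norm G r (ereal p) (tree_space G r (ereal p)) \<infinity> (mult_op \<psi>) = S"
    "op_norm G r (ereal p) (tree_space0 G r (ereal p)) \<infinity> (mult_op \<psi>) = S"
    using sub by (auto simp: S intro!: op_norm_mult_op[OF \<open>0 < p\<close>])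
  \<comment> \<open>By the norm identity, the norm condition in \<open>bounded_op\<close> is
    \<open>S < \<infinity>\<close>, which in turn implies the mapping property.\<close>
  have "a \<longleftrightarrow> S < \<infinity>"
    using mult_op_in_tree_space[OF \<open>0 < p\<close>, of \<psi>] by (auto simp: a_def bounded_op_def norms S)
  moreover have "b \<longleftrightarrow> S < \<infinity>"
    using mult_op_in_tree_space0[OF \<open>0 < p\<close>, of \<psi>] by (auto simp: b_def bounded_op_def norms S)
  ultimately show ?thesis
    using norms by blast
qed

end
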